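(* For every $t\in\mathbb{N}$ and any realization $m_{1:t}$ and $u_{1:t}$ (of positive probability), the transition probability of the number of faulty components satisfies $$\mathbb{P}(m_{t+1}\mid m_{1:t},u_{1:t})=\mathbb{P}(m_{t+1}\mid m_t,u_t),$$ where for any $y\in\{0,1,\ldots,n\}$: (i) if $m_t=0$ and $u_t\in\{1,2\}$, then $\mathbb{P}(m_{t+1}=y\mid m_t,u_t)=\mathrm{binopdf}(y,n,p)$; (ii) if $m_t=n$ and $u_t\in\{1,2\}$, then $\mathbb{P}(m_{t+1}=y\mid m_t,u_t)=\mathrm{binopdf}(y,n,1)=\mathbb{1}(y=n)$; (iii) if $m_t\notin\{0,n\}$ and $u_t\in\{1,2\}$, then $\mathbb{P}(m_{t+1}=y\mid m_t,u_t)=\phi(m_t,y+1)$; (iv) if $u_t=3$, then $\mathbb{P}(m_{t+1}=y\mid m_t,u_t)=\mathbb{1}(y=0)$.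
   Context: Notation: $\mathbb{N}=\{1,2,\ldots\}$, $\mathbb{1}(\cdot)$ is the indicator function, $x_{a:b}=(x_a,\ldots,x_b)$. $\mathrm{binopdf}(y,N,q)=\binom{N}{y}q^y(1-q)^{N-y}$ is the binomial probability of $y$ successes in $N$ trials with success probability $q$ (with $0^0=1$; it is $0$ for $y\notin\{0,\ldots,N\}$). Model: Let $n\in\mathbb{N}$ and $p\in[0,1]$. There are $n$ components; $x^i_t\in\{0,1\}$ is the state of component $i\in\{1,\ldots,n\}$ at time $t\in\mathbb{N}$ ($0$ = operating, $1$ = faulty). The action at time $t$ is $u_t\in\{1,2,3\}$ (1 = do nothing, 2 = inspect, 3 = repair). The dynamics are $\mathbb{P}(x^i_{t+1}=1\mid x^i_t=0,u_t\in\{1,2\})=p$, $\mathbb{P}(x^i_{t+1}=1\mid x^i_t=1,u_t\in\{1,2\})=1$, $\mathbb{P}(x^i_{t+1}=1\mid x^i_t=0,u_t=3)=0$, $\mathbb{P}(x^i_{t+1}=1\mid x^i_t=1,u_t=3)=0$. Failures of components are independent: given the whole past (states and actions up to time $t$), the next states $x^1_{t+1},\ldots,x^n_{t+1}$ are independent, and $x^i_{t+1}$ has the law above depending only on $(x^i_t,u_t)$. The number of faulty components is $m_t=\sum_{i=1}^n x^i_t\in\mathcal{M}=\{0,1,\ldots,n\}$. At time $1$ there are no faulty components, $m_1=0$. Initially $o_1=0$. The observation is $o_t\in\mathcal{M}\cup\{\mathtt{blank}\}$: if $u_t=1$ then $o_{t+1}=\mathtt{blank}$; if $u_t=2$ then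 $o_{t+1}=m_{t+1}$; if $u_t=3$ then $o_{t+1}=0$. Actions are chosen by a strategy $g$: $u_t=g(o_{1:t},u_{1:t-1})$. Definition of $\phi$: for $m\in\mathcal{M}\setminus\{0,n\}$, $\phi(m,\cdot)=\mathrm{binopdf}(\cdot,m,1)\ast\mathrm{binopdf}(\cdot,n-m,p)$, where $\ast$ is convolution of the vectors $(\mathrm{binopdf}(j,m,1))_{j=0}^{m}$ and $(\mathrm{binopdf}(j,n-m,p))_{j=0}^{n-m}$. The result is a vector with $n+1$ entries numbered $1,\ldots,n+1$, so that for $y\in\{0,\ldots,n\}$, $\phi(m,y+1)=\sum_{j=0}^{y}\mathrm{binopdf}(j,m,1)\,\mathrm{binopdf}(y-j,n-m,p)$. *)

theory Defs
  imports "HOL-Probability.Probability"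
begin

definition binopdf :: "nat \<Rightarrow> nat \<Rightarrow> real \<Rightarrow> real" where
  "binopdf y N q = real (N choose y) * q ^ y * (1 - q) ^ (N - y)"

lemma binopdf_eq_pmf:
  assumes "0 \<le> q" "q \<le> 1"
  shows "binopdf y N q = pmf (binomial_pmf N q) y"
  using assms by (simp add: binopdf_def)

text \<open>Finite vectors are represented by sequences that vanish beyond their last entry, as
  \<open>binopdf\<close> does.\<close>
definition conv :: "(nat \<Rightarrow> real) \<Rightarrow> (nat \<Rightarrow> real) \<Rightarrow> nat \<Rightarrow> real" where
  "conv f h y = (\<Sum>j\<le>y. f j * h (y - j))"

text \<open>The entries of the convolution are numbered from 1, so entry \<open>k\<close> is the value at \<open>k - 1\<close>.
  Only used for \<open>0 < m < n\<close> and \<open>1 \<le> k \<le> n + 1\<close>.\<close>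
definition phi :: "nat \<Rightarrow> real \<Rightarrow> nat \<Rightarrow> nat \<Rightarrow> real" where
  "phi n p m k = conv (\<lambda>j. binopdf j m 1) (\<lambda>j. binopdf j (n - m) p) (k - 1)"

text \<open>The actions 1, 2, 3, in this order.\<close>
datatype action = Do_Nothing | Inspect | Repair

text \<open>\<open>x i t \<omega>\<close> is the state of component \<open>i \<in> {1..n}\<close> at time \<open>t \<ge> 1\<close>
  (0 is operating, 1 is faulty).\<close>
definition num_faulty :: "nat \<Rightarrow> (nat \<Rightarrow> nat \<Rightarrow> 'a \<Rightarrow> nat) \<Rightarrow> nat \<Rightarrow> 'a \<Rightarrow> nat" where
  "num_faulty n x t \<omega> = (\<Sum>i\<in>{1..n}. x i t \<omega>)"

text \<open>Probability that a component in state \<open>s\<close> is faulty one step after action \<open>a\<close>.\<close>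
definition fail_prob :: "real \<Rightarrow> nat \<Rightarrow> action \<Rightarrow> real" where
  "fail_prob p s a = (if a = Repair then 0 else if s = 0 then p else 1)"

text \<open>The event that the component states and the actions up to time \<open>t\<close> are \<open>s\<close> and \<open>a\<close>.\<close>
definition past_event ::
  "'a measure \<Rightarrow> nat \<Rightarrow> (nat \<Rightarrow> nat \<Rightarrow> 'a \<Rightarrow> nat) \<Rightarrow> (nat \<Rightarrow> 'a \<Rightarrow> action) \<Rightarrow>
    nat \<Rightarrow> (nat \<Rightarrow> nat \<Rightarrow> nat) \<Rightarrow> (nat \<Rightarrow> action) \<Rightarrow> 'a set" where
  "past_event M n x u t s a =
    {\<omega> \<in> space M. \<forall>\<tau>\<in>{1..t}. (\<forall>i\<in>{1..n}. x i \<tau> \<omega> = s i \<tau>) \<and> u \<tau> \<omega> = a \<tau>}"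

text \<open>Observations are of type \<^typ>\<open>nat option\<close>, with \<^term>\<open>None\<close> for a blank one.  The strategy
  \<open>g\<close> maps the list of observations up to time \<open>t\<close> and the list of actions up to time \<open>t - 1\<close>
  to the action at time \<open>t\<close>; it may depend on \<open>t\<close> through the length of the lists.
  Values at time index 0 are irrelevant.\<close>
locale maintenance_model = prob_space M for M :: "'a measure" +
  fixes n :: nat and p :: real
    and x :: "nat \<Rightarrow> nat \<Rightarrow> 'a \<Rightarrow> nat"
    and u :: "nat \<Rightarrow> 'a \<Rightarrow> action"
    and obs :: "nat \<Rightarrow> 'a \<Rightarrow> nat option"
    and g :: "nat option list \<Rightarrow> action list \<Rightarrow> action"
  assumes n_pos: "n \<ge> 1"
    and p_ge_0: "0 \<le> p" and p_le_1: "p \<le> 1"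
    and x_rv: "\<And>i t. i \<in> {1..n} \<Longrightarrow> t \<ge> 1 \<Longrightarrow> random_variable (count_space UNIV) (x i t)"
    and u_rv: "\<And>t. t \<ge> 1 \<Longrightarrow> random_variable (count_space UNIV) (u t)"
    and obs_rv: "\<And>t. t \<ge> 1 \<Longrightarrow> random_variable (count_space UNIV) (obs t)"
    and x_states: "\<And>i t \<omega>. i \<in> {1..n} \<Longrightarrow> t \<ge> 1 \<Longrightarrow> \<omega> \<in> space M \<Longrightarrow> x i t \<omega> \<in> {0, 1}"
    and init_faulty: "\<And>\<omega>. \<omega> \<in> space M \<Longrightarrow> num_faulty n x 1 \<omega> = 0"
    and init_obs: "\<And>\<omega>. \<omega> \<in> space M \<Longrightarrow> obs 1 \<omega> = Some 0"
    and obs_step: "\<And>t \<omega>. t \<ge> 1 \<Longrightarrow> \<omega> \<in> space M \<Longrightarrow>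
      obs (t + 1) \<omega> = (case u t \<omega> of
          Do_Nothing \<Rightarrow> None
        | Inspect \<Rightarrow> Some (num_faulty n x (t + 1) \<omega>)
        | Repair \<Rightarrow> Some 0)"
    and strategy: "\<And>t \<omega>. t \<ge> 1 \<Longrightarrow> \<omega> \<in> space M \<Longrightarrow>
      u t \<omega> = g (map (\<lambda>\<tau>. obs \<tau> \<omega>) [1..<t + 1]) (map (\<lambda>\<tau>. u \<tau> \<omega>) [1..<t])"
    and next_state_law: "\<And>t s a i. t \<ge> 1 \<Longrightarrow> i \<in> {1..n} \<Longrightarrow>
      prob (past_event M n x u t s a) > 0 \<Longrightarrow>
      \<P>(\<omega> in M. x i (t + 1) \<omega> = 1 \<bar> \<omega> \<in> past_event M n x u t s a) = fail_prob p (s i t) (a t)"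
    and next_states_indep: "\<And>t s a. t \<ge> 1 \<Longrightarrow>
      prob (past_event M n x u t s a) > 0 \<Longrightarrow>
      prob_space.indep_vars (uniform_measure M (past_event M n x u t s a))
        (\<lambda>_. count_space UNIV) (\<lambda>i. x i (t + 1)) {1..n}"

end

theory Submission
  imports Defs
begin

text \<open>
  Fix a complete history of component states and actions up to time \<open>t\<close>, ending with \<open>m\<close> faulty
  components and action \<open>a\<close>. Given this history the next states are independent. If \<open>a\<close> is not a
  repair, the \<open>m\<close> faulty components stay faulty and each of the other \<open>n - m\<close> fails with
  probability \<open>p\<close>, so the next count is \<open>m\<close> plus a binomial variable with \<open>n - m\<close> trials
  (\<open>transition_given_past_event\<close>); after a repair it is 0. In either case its law depends on the
  history through \<open>m\<close> and \<open>a\<close> alone.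

  An event that is decided by the history and on which \<open>m\<close> and \<open>a\<close> are constant is a finite
  disjoint union of complete histories. They all lead to the same conditional law, hence averaging
  over them gives this law again (\<open>transition_given_saturated_event\<close>). Both conditions in the
  theorem, the past counts and actions as well as the current count and action, are events of this
  kind, since the component states determine the counts. So both conditional probabilities equal
  the same kernel \<open>transition_prob\<close>, which is the Markov property, and the four cases are special
  values of that kernel.
\<close>

section \<open>Sums of independent indicators\<close>

lemma binopdf_sure: "binopdf y N 1 = of_bool (y = N)"
  by (cases "y < N") (auto simp: binopdf_def)

lemma binopdf_never: "binopdf y N 0 = of_bool (y = 0)"
  by (cases "y = 0") (auto simp: binopdf_def)

text \<open>The set \<open>B\<close> prescribes which indicators are 1. By independence the probability of such a
  pattern is a product with a factor for each index; as all indices share the same \<open>q\<close>, it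
  depends on \<open>B\<close> only through its cardinality.\<close>
lemma (in prob_space) indep_indicators_prob_pattern:
  fixes X :: "'i \<Rightarrow> 'a \<Rightarrow> nat"
  assumes "finite I"
    and indep: "indep_vars (\<lambda>_. count_space UNIV) X I"
    and states: "\<And>i \<omega>. i \<in> I \<Longrightarrow> \<omega> \<in> space M \<Longrightarrow> X i \<omega> \<in> {0, 1}"
    and q: "\<And>i. i \<in> I \<Longrightarrow> \<P>(\<omega> in M. X i \<omega> = 1) = q"
    and "B \<subseteq> I"
  shows "\<P>(\<omega> in M. \<forall>i\<in>I. X i \<omega> = of_bool (i \<in> B)) = q ^ card B * (1 - q) ^ (card I - card B)"
proof (cases "I = {}")
  case True
  then show ?thesis using \<open>B \<subseteq> I\<close> by (simp add: prob_space)
next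
  case False
  have rv: "X i \<in> measurable M (count_space UNIV)" if "i \<in> I" for i
    using indep that by (auto simp: indep_vars_def2)
  have q': "\<P>(\<omega> in M. X i \<omega> = 0) = 1 - q" if "i \<in> I" for i
  proof -
    have "{\<omega> \<in> space M. X i \<omega> = 0} = {\<omega> \<in> space M. \<not> X i \<omega> = 1}"
      using states[OF that] by fastforce
    moreover have "{\<omega> \<in> space M. X i \<omega> = 1} \<in> events"
      using rv[OF that] by measurable
    ultimately show ?thesis
      using prob_neg[of "\<lambda>\<omega>. X i \<omega> = 1"] q[OF that] by simp
  qed
  have "\<P>(\<omega> in M. \<forall>i\<in>I. X i \<omega> = of_bool (i \<in> B))
      = prob (\<Inter>i\<in>I. X i -` {of_bool (i \<in> B)} \<inter> space M)"
    using False by (intro arg_cong[where f = prob]) auto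
  also have "\<dots> = (\<Prod>i\<in>I. prob (X i -` {of_bool (i \<in> B)} \<inter> space M))"
    by (rule indep_varsD[OF indep False \<open>finite I\<close>]) auto
  also have "\<dots> = (\<Prod>i\<in>I. if i \<in> B then q else 1 - q)"
    using q q' by (intro prod.cong) (auto simp: vimage_def Int_def conj_commute)
  also have "\<dots> = (\<Prod>i\<in>B. q) * (\<Prod>i\<in>I - B. 1 - q)"
    using \<open>finite I\<close> \<open>B \<subseteq> I\<close>
    by (simp add: prod.If_cases Int_absorb1 Diff_eq)
  also have "\<dots> = q ^ card B * (1 - q) ^ (card I - card B)"
    using \<open>finite I\<close> \<open>B \<subseteq> I\<close> by (simp add: card_Diff_subset finite_subset)
  finally show ?thesis .
qed

text \<open>The sum is \<open>y\<close> exactly when the indices with value 1 form a set of cardinality \<open>y\<close>. These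
  patterns are disjoint and equally likely, and the binomial coefficient counts them.\<close>
lemma (in prob_space) indep_indicators_sum_binomial:
  fixes X :: "'i \<Rightarrow> 'a \<Rightarrow> nat"
  assumes "finite I"
    and indep: "indep_vars (\<lambda>_. count_space UNIV) X I"
    and states: "\<And>i \<omega>. i \<in> I \<Longrightarrow> \<omega> \<in> space M \<Longrightarrow> X i \<omega> \<in> {0, 1}"
    and q: "\<And>i. i \<in> I \<Longrightarrow> \<P>(\<omega> in M. X i \<omega> = 1) = q"
  shows "\<P>(\<omega> in M. (\<Sum>i\<in>I. X i \<omega>) = y) = binopdf y (card I) q"
proof -
  define E where "E B = {\<omega> \<in> space M. \<forall>i\<in>I. X i \<omega> = of_bool (i \<in> B)}" for B
  let ?K = "{B. B \<subseteq> I \<and> card B = y}"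
  have rv: "X i \<in> measurable M (count_space UNIV)" if "i \<in> I" for i
    using indep that by (auto simp: indep_vars_def2)
  have "E B \<in> events" for B
    unfolding E_def using rv \<open>finite I\<close> by measurable
  moreover have "disjoint_family_on E ?K"
    by (fastforce simp: disjoint_family_on_def E_def of_bool_def split: if_splits)
  moreover have fin: "finite ?K"
    using \<open>finite I\<close> by simp
  ultimately have "prob (\<Union>B\<in>?K. E B) = (\<Sum>B\<in>?K. prob (E B))"
    by (intro finite_measure_finite_Union) auto
  moreover have "{\<omega> \<in> space M. (\<Sum>i\<in>I. X i \<omega>) = y} = (\<Union>B\<in>?K. E B)"
  proof -
    have ones: "(\<Sum>i\<in>I. of_bool (i \<in> B) :: nat) = card B" if "B \<subseteq> I" for B
      using \<open>finite I\<close> that by (simp add: Int_absorb1)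
    have pattern: "\<omega> \<in> E {i \<in> I. X i \<omega> = 1}" if "\<omega> \<in> space M" for \<omega>
      using states[OF _ that] that by (fastforce simp: E_def)
    have sum: "(\<Sum>i\<in>I. X i \<omega>) = card B" if "\<omega> \<in> E B" "B \<subseteq> I" for \<omega> B
      using that ones by (simp add: E_def)
    show ?thesis
    proof (intro equalityI subsetI)
      fix \<omega> assume \<omega>: "\<omega> \<in> {\<omega> \<in> space M. (\<Sum>i\<in>I. X i \<omega>) = y}"
      then have "card {i \<in> I. X i \<omega> = 1} = y"
        using sum[OF pattern, of \<omega>] by auto
      then show "\<omega> \<in> (\<Union>B\<in>?K. E B)"
        using \<omega> by (intro UN_I[of "{i \<in> I. X i \<omega> = 1}"] pattern) auto
    next
      fix \<omega> assume "\<omega> \<in> (\<Union>B\<in>?K. E B)"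
      then show "\<omega> \<in> {\<omega> \<in> space M. (\<Sum>i\<in>I. X i \<omega>) = y}"
        using sum by (auto simp: E_def)
    qed
  qed
  moreover have "prob (E B) = q ^ y * (1 - q) ^ (card I - y)" if "B \<in> ?K" for B
    unfolding E_def using indep_indicators_prob_pattern[OF assms, of B] that by auto
  ultimately show ?thesis
    using n_subsets[OF \<open>finite I\<close>, of y] by (simp add: binopdf_def)
qed

text \<open>The indices in \<open>F\<close>, which stand for components that are already faulty, contribute the
  constant \<open>card F\<close> almost surely, so the binomial law of the remaining ones is shifted by it.
  The indicator factor is needed because \<open>y - card F\<close> truncates at 0.\<close>
lemma (in prob_space) indep_indicators_sum_shifted_binomial:
  fixes X :: "'i \<Rightarrow> 'a \<Rightarrow> nat"
  assumes "finite I" and "F \<subseteq> I"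
    and indep: "indep_vars (\<lambda>_. count_space UNIV) X I"
    and states: "\<And>i \<omega>. i \<in> I \<Longrightarrow> \<omega> \<in> space M \<Longrightarrow> X i \<omega> \<in> {0, 1}"
    and sure: "\<And>i. i \<in> F \<Longrightarrow> \<P>(\<omega> in M. X i \<omega> = 1) = 1"
    and q: "\<And>i. i \<in> I - F \<Longrightarrow> \<P>(\<omega> in M. X i \<omega> = 1) = q"
  shows "\<P>(\<omega> in M. (\<Sum>i\<in>I. X i \<omega>) = y)
    = of_bool (card F \<le> y) * binopdf (y - card F) (card I - card F) q"
proof -
  have rv: "X i \<in> measurable M (count_space UNIV)" if "i \<in> I" for i
    using indep that by (auto simp: indep_vars_def2)
  have fin: "finite F"
    using assms finite_subset by blast
  have "AE \<omega> in M. X i \<omega> = 1" if "i \<in> F" for i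
    using sure[OF that] rv[of i] that \<open>F \<subseteq> I\<close>
    by (subst (asm) prob_Collect_eq_1) auto
  then have "AE \<omega> in M. \<forall>i\<in>F. X i \<omega> = 1"
    using fin by (simp add: AE_finite_all)
  then have sum: "AE \<omega> in M. (\<Sum>i\<in>I. X i \<omega>) = card F + (\<Sum>i\<in>I - F. X i \<omega>)"
  proof eventually_elim
    case (elim \<omega>)
    then show ?case
      using sum.subset_diff[OF \<open>F \<subseteq> I\<close> \<open>finite I\<close>, of "\<lambda>i. X i \<omega>"] by simp
  qed
  have meas: "(\<lambda>\<omega>. \<Sum>i\<in>J. X i \<omega>) \<in> measurable M (count_space UNIV)" if "J \<subseteq> I" for J
    using that rv by (intro measurable_sum_nat) auto
  have "\<P>(\<omega> in M. (\<Sum>i\<in>I. X i \<omega>) = y) = \<P>(\<omega> in M. card F + (\<Sum>i\<in>I - F. X i \<omega>) = y)"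
    using sum meas[of I] meas[of "I - F"]
    by (intro prob_eq_AE) auto
  also have "\<dots> = of_bool (card F \<le> y) * \<P>(\<omega> in M. (\<Sum>i\<in>I - F. X i \<omega>) = y - card F)"
  proof (cases "card F \<le> y")
    case True
    then have "card F + k = y \<longleftrightarrow> k = y - card F" for k by auto
    then show ?thesis using True by simp
  qed auto
  also have "\<P>(\<omega> in M. (\<Sum>i\<in>I - F. X i \<omega>) = y - card F) = binopdf (y - card F) (card (I - F)) q"
    using \<open>finite I\<close> indep_vars_subset[OF indep, of "I - F"] states q
    by (intro indep_indicators_sum_binomial) auto
  finally show ?thesis
    using fin \<open>F \<subseteq> I\<close> by (simp add: card_Diff_subset)
qed

section \<open>The transition kernel given a complete history\<close>

text \<open>Away from a repair this is the convolution of a point mass at \<open>m\<close> with the binomial law of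
  the new failures, in closed form. The closed form also makes sense for \<open>m = 0\<close> and \<open>m = n\<close>, so
  that one kernel covers all the cases.\<close>
definition transition_prob :: "nat \<Rightarrow> real \<Rightarrow> nat \<Rightarrow> action \<Rightarrow> nat \<Rightarrow> real" where
  "transition_prob n p m a y =
    (if a = Repair then of_bool (y = 0) else of_bool (m \<le> y) * binopdf (y - m) (n - m) p)"

lemma phi_eq_shifted_binopdf:
  "phi n p m (y + 1) = of_bool (m \<le> y) * binopdf (y - m) (n - m) p"
proof -
  have "phi n p m (y + 1) = (\<Sum>j\<le>y. if j = m then binopdf (y - j) (n - m) p else 0)"
    unfolding phi_def conv_def by (intro sum.cong) (auto simp: binopdf_sure)
  then show ?thesis by simp
qed

context maintenance_model
begin

lemma measurable_num_faulty:
  assumes "t \<ge> 1"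
  shows "num_faulty n x t \<in> measurable M (count_space UNIV)"
proof -
  have "(\<lambda>\<omega>. \<Sum>i\<in>{1..n}. x i t \<omega>) \<in> measurable M (count_space UNIV)"
    using x_rv assms by (intro measurable_sum_nat) auto
  then show ?thesis
    by (simp add: num_faulty_def[abs_def])
qed

lemma past_event_in_events: "past_event M n x u t s a \<in> events"
proof -
  have [measurable]: "x i \<tau> \<in> measurable M (count_space UNIV)"
    if "i \<in> {1..n}" "\<tau> \<in> {1..t}" for i \<tau>
    using x_rv that by auto
  have [measurable]: "u \<tau> \<in> measurable M (count_space UNIV)" if "\<tau> \<in> {1..t}" for \<tau>
    using u_rv that by auto
  show ?thesis
    unfolding past_event_def by measurable
qed

text \<open>The law of the sum of the next states is computed in the conditional measure, where these
  states are independent by assumption. The equation is stated without division, so that it can be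
  summed over histories.\<close>
lemma transition_given_past_event:
  assumes "t \<ge> 1"
    and pos: "prob (past_event M n x u t s a) > 0"
    and s: "\<And>i. i \<in> {1..n} \<Longrightarrow> s i t \<in> {0, 1}"
  shows "prob ({\<omega> \<in> space M. num_faulty n x (t + 1) \<omega> = y} \<inter> past_event M n x u t s a)
    = transition_prob n p (\<Sum>i\<in>{1..n}. s i t) (a t) y * prob (past_event M n x u t s a)"
proof -
  let ?E = "past_event M n x u t s a"
  let ?N = "uniform_measure M ?E"
  \<comment> \<open>A repair fits the shifted binomial law as well: no component is surely faulty, and each one
    is faulty with probability 0.\<close>
  define F where "F = (if a t = Repair then {} else {i \<in> {1..n}. s i t = 1})"
  define q where "q = (if a t = Repair then 0 else p)"
  have E: "?E \<in> events" "emeasure M ?E \<noteq> 0" "emeasure M ?E \<noteq> \<infinity>"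
    using past_event_in_events pos by (auto simp: emeasure_eq_measure)
  interpret N: prob_space ?N
    using E by (intro prob_space_uniform_measure) auto
  have N_prob: "\<P>(\<omega> in ?N. Q \<omega>) = prob ({\<omega> \<in> space M. Q \<omega>} \<inter> ?E) / prob ?E"
    if "{\<omega> \<in> space M. Q \<omega>} \<in> events" for Q
    using measure_uniform_measure[OF E(2,3) that] by (simp add: Int_commute)
  have law: "\<P>(\<omega> in ?N. x i (t + 1) \<omega> = 1) = fail_prob p (s i t) (a t)" if "i \<in> {1..n}" for i
  proof -
    have "x i (t + 1) \<in> measurable M (count_space UNIV)"
      using x_rv that by auto
    then have "{\<omega> \<in> space M. x i (t + 1) \<omega> = 1} \<in> events"
      by measurable
    moreover have "{\<omega> \<in> space M. x i (t + 1) \<omega> = 1} \<inter> ?E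
        = {\<omega> \<in> space M. x i (t + 1) \<omega> = 1 \<and> \<omega> \<in> ?E}"
      and "{\<omega> \<in> space M. \<omega> \<in> ?E} = ?E"
      using E(1)[THEN sets.sets_into_space] by auto
    ultimately show ?thesis
      using next_state_law[OF \<open>t \<ge> 1\<close> that pos] N_prob by (simp add: cond_prob_def)
  qed
  have "\<P>(\<omega> in ?N. (\<Sum>i\<in>{1..n}. x i (t + 1) \<omega>) = y)
      = of_bool (card F \<le> y) * binopdf (y - card F) (card {1..n} - card F) q"
  proof (rule N.indep_indicators_sum_shifted_binomial)
    show "N.indep_vars (\<lambda>_. count_space UNIV) (\<lambda>i. x i (t + 1)) {1..n}"
      using next_states_indep[OF \<open>t \<ge> 1\<close> pos] .
    show "x i (t + 1) \<omega> \<in> {0, 1}" if "i \<in> {1..n}" "\<omega> \<in> space ?N" for i \<omega>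
      using x_states[of i "t + 1" \<omega>] that by simp
    show "\<P>(\<omega> in ?N. x i (t + 1) \<omega> = 1) = 1" if "i \<in> F" for i
      using law[of i] that by (auto simp: F_def fail_prob_def split: if_splits)
    show "\<P>(\<omega> in ?N. x i (t + 1) \<omega> = 1) = q" if "i \<in> {1..n} - F" for i
      using law[of i] s[of i] that by (auto simp: F_def q_def fail_prob_def split: if_splits)
  qed (auto simp: F_def)
  also have "\<dots> = transition_prob n p (\<Sum>i\<in>{1..n}. s i t) (a t) y"
  proof (cases "a t = Repair")
    case False
    have "(\<Sum>i\<in>{1..n}. s i t) = (\<Sum>i\<in>{1..n}. of_bool (s i t = 1))"
      using s by (intro sum.cong) fastforce+
    then have "card F = (\<Sum>i\<in>{1..n}. s i t)"
      using False by (simp add: F_def sum_of_bool_eq Int_def)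
    then show ?thesis
      using False by (simp add: transition_prob_def q_def)
  qed (simp add: F_def q_def transition_prob_def binopdf_never)
  finally have "\<P>(\<omega> in ?N. num_faulty n x (t + 1) \<omega> = y)
      = transition_prob n p (\<Sum>i\<in>{1..n}. s i t) (a t) y"
    by (simp add: num_faulty_def)
  moreover have "{\<omega> \<in> space M. num_faulty n x (t + 1) \<omega> = y} \<in> events"
    using measurable_num_faulty[of "t + 1"] by measurable
  ultimately show ?thesis
    using N_prob[of "\<lambda>\<omega>. num_faulty n x (t + 1) \<omega> = y"] pos by (simp add: field_simps)
qed

section \<open>Averaging over histories\<close>

text \<open>The atom of \<open>\<omega>\<close> in the partition of the sample space by complete histories up to time \<open>t\<close>.\<close>
abbreviation same_past :: "nat \<Rightarrow> 'a \<Rightarrow> 'a set" where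
  "same_past t \<omega> \<equiv> past_event M n x u t (\<lambda>i \<tau>. x i \<tau> \<omega>) (\<lambda>\<tau>. u \<tau> \<omega>)"

lemma finite_same_past: "finite (same_past t ` space M)"
proof -
  \<comment> \<open>Restricting the histories to the relevant indices leaves functions between finite sets.\<close>
  define H where "H \<omega> = (\<lambda>i\<in>{1..n}. \<lambda>\<tau>\<in>{1..t}. x i \<tau> \<omega>, \<lambda>\<tau>\<in>{1..t}. u \<tau> \<omega>)" for \<omega>
  have "(UNIV :: action set) = {Do_Nothing, Inspect, Repair}"
    using action.exhaust by blast
  then have "finite (UNIV :: action set)"
    by (metis finite.emptyI finite_insert)
  then have "finite (({1..n} \<rightarrow>\<^sub>E ({1..t} \<rightarrow>\<^sub>E {0, 1 :: nat})) \<times> ({1..t} \<rightarrow>\<^sub>E (UNIV :: action set)))"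
    by (intro finite_cartesian_product finite_PiE) auto
  moreover have "H ` space M \<subseteq> ({1..n} \<rightarrow>\<^sub>E ({1..t} \<rightarrow>\<^sub>E {0, 1})) \<times> ({1..t} \<rightarrow>\<^sub>E UNIV)"
    using x_states by (fastforce simp: H_def PiE_iff)
  ultimately have "finite (H ` space M)"
    by (rule finite_subset[rotated])
  moreover have "same_past t \<omega> = (\<lambda>(s, a). past_event M n x u t s a) (H \<omega>)" for \<omega>
    by (auto simp: H_def past_event_def)
  then have "same_past t ` space M = (\<lambda>(s, a). past_event M n x u t s a) ` H ` space M"
    by (simp add: image_image)
  ultimately show ?thesis by simp
qed

text \<open>The event \<open>C\<close> is the disjoint union of the atoms of its elements. The factor
  \<open>transition_prob n p m a y\<close> is the same for each atom, so it can be taken out of the sum. This is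
  where information about the past other than \<open>m\<close> and \<open>a\<close> drops out.\<close>
lemma transition_given_saturated_event:
  assumes "t \<ge> 1"
    and "C \<subseteq> space M"
    and saturated: "\<And>\<omega>. \<omega> \<in> C \<Longrightarrow> same_past t \<omega> \<subseteq> C"
    and current: "\<And>\<omega>. \<omega> \<in> C \<Longrightarrow> num_faulty n x t \<omega> = m \<and> u t \<omega> = a"
  shows "prob ({\<omega> \<in> space M. num_faulty n x (t + 1) \<omega> = y} \<inter> C)
    = transition_prob n p m a y * prob C"
proof -
  let ?D = "{\<omega> \<in> space M. num_faulty n x (t + 1) \<omega> = y}"
  let ?P = "same_past t ` C"
  have fin: "finite ?P"
    using finite_same_past \<open>C \<subseteq> space M\<close> by (rule finite_subset[rotated, OF _ image_mono])
  have D: "?D \<in> events"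
    using measurable_num_faulty[of "t + 1"] by measurable
  have disj: "disjoint_family_on (\<lambda>E. E) ?P"
  proof -
    have "same_past t \<omega> = same_past t \<omega>'" if "\<omega>'' \<in> same_past t \<omega> \<inter> same_past t \<omega>'" for \<omega> \<omega>' \<omega>''
      using that by (auto simp: past_event_def)
    then show ?thesis by (fastforce simp: disjoint_family_on_def)
  qed
  have union: "C = \<Union>?P"
    using \<open>C \<subseteq> space M\<close> saturated by (auto simp: past_event_def)
  have block: "prob (?D \<inter> E) = transition_prob n p m a y * prob E" if "E \<in> ?P" for E
  proof -
    obtain \<omega> where \<omega>: "\<omega> \<in> C" "E = same_past t \<omega>" using \<open>E \<in> ?P\<close> by auto
    show ?thesis
    proof (cases "prob E > 0")
      case True
      then show ?thesis
        using transition_given_past_event[OF \<open>t \<ge> 1\<close>, of "\<lambda>i \<tau>. x i \<tau> \<omega>" "\<lambda>\<tau>. u \<tau> \<omega>" y]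
          current[of \<omega>] x_states[of _ t \<omega>] \<omega> \<open>C \<subseteq> space M\<close> \<open>t \<ge> 1\<close>
        by (auto simp: num_faulty_def)
    next
      \<comment> \<open>The conditional laws say nothing about a null history, but then both sides vanish.\<close>
      case False
      then have "prob E = 0" using measure_nonneg[of M E] by linarith
      moreover have "prob (?D \<inter> E) \<le> prob E"
        using \<omega> past_event_in_events by (intro finite_measure_mono) auto
      ultimately show ?thesis
        by (simp add: measure_le_0_iff)
    qed
  qed
  have "?D \<inter> C = ?D \<inter> \<Union>?P"
    using union by (rule arg_cong)
  then have "prob (?D \<inter> C) = prob (\<Union>E\<in>?P. ?D \<inter> E)"
    by (simp only: Int_Union)
  also have "\<dots> = (\<Sum>E\<in>?P. prob (?D \<inter> E))"
    using fin disj D past_event_in_events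
    by (intro finite_measure_finite_Union) (auto simp: disjoint_family_on_def)
  also have "\<dots> = transition_prob n p m a y * (\<Sum>E\<in>?P. prob E)"
    using block by (simp add: sum_distrib_left)
  also have "(\<Sum>E\<in>?P. prob E) = prob (\<Union>E\<in>?P. E)"
    using fin disj past_event_in_events
    by (intro finite_measure_finite_Union[symmetric]) auto
  also have "(\<Union>E\<in>?P. E) = C"
    using union by simp
  finally show ?thesis .
qed

text \<open>For a condition \<open>Q\<close> that the history decides, which makes its event a union of atoms.\<close>
lemma cond_transition:
  assumes "t \<ge> 1"
    and pos: "\<P>(\<omega> in M. Q \<omega>) > 0"
    and determined: "\<And>\<omega> \<omega>'. \<omega> \<in> space M \<Longrightarrow> Q \<omega> \<Longrightarrow> \<omega>' \<in> same_past t \<omega> \<Longrightarrow> Q \<omega>'"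
    and current: "\<And>\<omega>. \<omega> \<in> space M \<Longrightarrow> Q \<omega> \<Longrightarrow> num_faulty n x t \<omega> = m \<and> u t \<omega> = a"
  shows "\<P>(\<omega> in M. num_faulty n x (t + 1) \<omega> = y \<bar> Q \<omega>) = transition_prob n p m a y"
proof -
  let ?C = "{\<omega> \<in> space M. Q \<omega>}"
  have "prob ({\<omega> \<in> space M. num_faulty n x (t + 1) \<omega> = y} \<inter> ?C)
      = transition_prob n p m a y * prob ?C"
  proof (rule transition_given_saturated_event[OF \<open>t \<ge> 1\<close>])
    show "same_past t \<omega> \<subseteq> ?C" if "\<omega> \<in> ?C" for \<omega>
      using determined[of \<omega>] that by (auto simp: past_event_def)
  qed (use current in auto)
  moreover have "{\<omega> \<in> space M. num_faulty n x (t + 1) \<omega> = y} \<inter> ?C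
      = {\<omega> \<in> space M. num_faulty n x (t + 1) \<omega> = y \<and> Q \<omega>}"
    by auto
  ultimately show ?thesis
    using pos by (simp add: cond_prob_def)
qed

lemma same_past_agrees:
  assumes "\<omega>' \<in> same_past t \<omega>" and "\<tau> \<in> {1..t}"
  shows "num_faulty n x \<tau> \<omega>' = num_faulty n x \<tau> \<omega>" and "u \<tau> \<omega>' = u \<tau> \<omega>"
  using assms by (auto simp: past_event_def num_faulty_def intro!: sum.cong)

end

section \<open>The Markov property and the transition probabilities\<close>

theorem theorem1:
  fixes M :: "'a measure" and n :: nat and p :: real
    and x :: "nat \<Rightarrow> nat \<Rightarrow> 'a \<Rightarrow> nat"
    and u :: "nat \<Rightarrow> 'a \<Rightarrow> action"
    and obs :: "nat \<Rightarrow> 'a \<Rightarrow> nat option"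
    and g :: "nat option list \<Rightarrow> action list \<Rightarrow> action"
    and t :: nat and m' :: "nat \<Rightarrow> nat" and u' :: "nat \<Rightarrow> action"
  assumes "maintenance_model M n p x u obs g"
    and "t \<ge> 1"
    and "\<P>(\<omega> in M. \<forall>\<tau>\<in>{1..t}. num_faulty n x \<tau> \<omega> = m' \<tau> \<and> u \<tau> \<omega> = u' \<tau>) > 0"
  shows "\<forall>y\<in>{0..n}.
    \<P>(\<omega> in M. num_faulty n x (t + 1) \<omega> = y
        \<bar> \<forall>\<tau>\<in>{1..t}. num_faulty n x \<tau> \<omega> = m' \<tau> \<and> u \<tau> \<omega> = u' \<tau>)
      = \<P>(\<omega> in M. num_faulty n x (t + 1) \<omega> = y \<bar> num_faulty n x t \<omega> = m' t \<and> u t \<omega> = u' t)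
    \<and> (m' t = 0 \<and> u' t \<in> {Do_Nothing, Inspect} \<longrightarrow>
        \<P>(\<omega> in M. num_faulty n x (t + 1) \<omega> = y \<bar> num_faulty n x t \<omega> = m' t \<and> u t \<omega> = u' t)
          = binopdf y n p)
    \<and> (m' t = n \<and> u' t \<in> {Do_Nothing, Inspect} \<longrightarrow>
        \<P>(\<omega> in M. num_faulty n x (t + 1) \<omega> = y \<bar> num_faulty n x t \<omega> = m' t \<and> u t \<omega> = u' t)
          = binopdf y n 1
        \<and> binopdf y n 1 = of_bool (y = n))
    \<and> (m' t \<notin> {0, n} \<and> u' t \<in> {Do_Nothing, Inspect} \<longrightarrow>
        \<P>(\<omega> in M. num_faulty n x (t + 1) \<omega> = y \<bar> num_faulty n x t \<omega> = m' t \<and> u t \<omega> = u' t)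
          = phi n p (m' t) (y + 1))
    \<and> (u' t = Repair \<longrightarrow>
        \<P>(\<omega> in M. num_faulty n x (t + 1) \<omega> = y \<bar> num_faulty n x t \<omega> = m' t \<and> u t \<omega> = u' t)
          = of_bool (y = 0))"
proof -
  interpret maintenance_model M n p x u obs g by fact
  let ?H = "\<lambda>\<omega>. \<forall>\<tau>\<in>{1..t}. num_faulty n x \<tau> \<omega> = m' \<tau> \<and> u \<tau> \<omega> = u' \<tau>"
  let ?Q = "\<lambda>\<omega>. num_faulty n x t \<omega> = m' t \<and> u t \<omega> = u' t"
  have t: "t \<in> {1..t}" using \<open>t \<ge> 1\<close> by simp
  have given_history: "\<P>(\<omega> in M. num_faulty n x (t + 1) \<omega> = y \<bar> ?H \<omega>)
      = transition_prob n p (m' t) (u' t) y" for y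
    using assms(2,3) t by (intro cond_transition) (auto simp: same_past_agrees)
  \<comment> \<open>The current count and action are part of the past, so their event has positive probability
    too.\<close>
  have "{\<omega> \<in> space M. ?Q \<omega>} \<in> events"
    using measurable_num_faulty[OF \<open>t \<ge> 1\<close>] u_rv[OF \<open>t \<ge> 1\<close>] by measurable
  then have "\<P>(\<omega> in M. ?H \<omega>) \<le> \<P>(\<omega> in M. ?Q \<omega>)"
    using t by (intro finite_measure_mono) auto
  then have given_current: "\<P>(\<omega> in M. num_faulty n x (t + 1) \<omega> = y \<bar> ?Q \<omega>)
      = transition_prob n p (m' t) (u' t) y" for y
    using assms(2,3) t by (intro cond_transition) (auto simp: same_past_agrees)
  show ?thesis
    unfolding given_history given_current phi_eq_shifted_binopdf binopdf_sure
    by (auto simp: transition_prob_def binopdf_def)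
qed

end
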